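(* Consider the Gaussian sequence model $Y=\mu+Z$, $Z\sim N(0,I_n)$, with $\mu$ constrained to the ellipsoid $$K_n=\Big\{\mu=(u,t)\in\mathbb R^{n-1}\times\mathbb R:\ \|u\|_2^2+\frac{t^2}{\sqrt n}\le1\Big\},$$ and let $\hat\mu^{\mathrm{unif}}(Y)=\mathbb E_{\Pi_n}[\mu\mid Y]$ be the posterior mean under the uniform prior $\Pi_n=\mathrm{Unif}(K_n)$. There exist universal constants $c>0$ and $n_0<\infty$ such that for every $n\ge n_0$, $$\sup_{\mu\in K_n}\mathbb E_\mu\big\|\hat\mu^{\mathrm{unif}}(Y)-\mu\big\|_2^2\ge c\sqrt n .$$ On the other hand, $$\inf_{\hat\mu}\sup_{\mu\in K_n}\mathbb E_\mu\|\hat\mu(Y)-\mu\|_2^2\le2 .$$ Consequently the posterior mean under the uniform prior is not minimax, and its worst-case risk can exceed the minimax risk by a factor of order $\sqrt n$. More concretely, one may take $c=1/32$ for all sufficiently large $n$.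
   Context: $\mathbb E_\mu$ is expectation when the true mean is $\mu$; the infimum is over all measurable estimators. The posterior is with respect to the likelihood of $Y\mid\mu\sim N(\mu,I_n)$ and prior the uniform (normalized Lebesgue) measure on $K_n$. *)

theory Defs
  imports "HOL-Probability.Probability"
begin

text \<open>
  Since the dimension \<open>n\<close> is quantified inside the statement, \<open>\<real>\<^sup>n\<close> is the space of
  extensional functions on \<open>{..<n}\<close>, with the product Lebesgue measure. Risks are
  extended nonnegative reals, so that an estimator with a non-integrable loss has risk
  \<open>\<infinity>\<close> and not the default value \<open>0\<close> of the Bochner integral.
\<close>

definition lebesgue_n :: "nat \<Rightarrow> (nat \<Rightarrow> real) measure" where
  "lebesgue_n n = Pi\<^sub>M {..<n} (\<lambda>_. lborel)"

definition gauss_measure :: "nat \<Rightarrow> (nat \<Rightarrow> real) \<Rightarrow> (nat \<Rightarrow> real) measure" where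
  "gauss_measure n \<mu> = Pi\<^sub>M {..<n} (\<lambda>i. density lborel (normal_density (\<mu> i) 1))"

definition gauss_likelihood :: "nat \<Rightarrow> (nat \<Rightarrow> real) \<Rightarrow> (nat \<Rightarrow> real) \<Rightarrow> real" where
  "gauss_likelihood n y \<mu> = (\<Prod>i<n. normal_density (\<mu> i) 1 (y i))"

text \<open>The coordinates of \<open>u\<close> are \<open>0, \<dots>, n - 2\<close>, and \<open>t\<close> is the coordinate \<open>n - 1\<close>.\<close>

definition ellipsoid :: "nat \<Rightarrow> (nat \<Rightarrow> real) set" where
  "ellipsoid n = {\<mu> \<in> {..<n} \<rightarrow>\<^sub>E UNIV.
     (\<Sum>i<n - 1. (\<mu> i)\<^sup>2) + (\<mu> (n - 1))\<^sup>2 / sqrt (real n) \<le> 1}"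

text \<open>
  Bayes' formula, for a prior and a likelihood function of the parameter at the observed
  data. For the Gaussian likelihood the normalizing constant is positive and finite for
  every observation.
\<close>

definition posterior :: "'a measure \<Rightarrow> ('a \<Rightarrow> real) \<Rightarrow> 'a measure" where
  "posterior \<pi> L = density \<pi> (\<lambda>\<theta>. ennreal (L \<theta>) / (\<integral>\<^sup>+ \<theta>'. ennreal (L \<theta>') \<partial>\<pi>))"

definition posterior_mean ::
    "nat \<Rightarrow> (nat \<Rightarrow> real) measure \<Rightarrow> (nat \<Rightarrow> real) \<Rightarrow> (nat \<Rightarrow> real)" where
  "posterior_mean n \<pi> y =
     (\<lambda>i\<in>{..<n}. \<integral>\<mu>. \<mu> i \<partial>posterior \<pi> (gauss_likelihood n y))"

definition unif_posterior_mean :: "nat \<Rightarrow> (nat \<Rightarrow> real) \<Rightarrow> (nat \<Rightarrow> real)" where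
  "unif_posterior_mean n =
     posterior_mean n (uniform_measure (lebesgue_n n) (ellipsoid n))"

definition risk ::
    "nat \<Rightarrow> ((nat \<Rightarrow> real) \<Rightarrow> (nat \<Rightarrow> real)) \<Rightarrow> (nat \<Rightarrow> real) \<Rightarrow> ennreal" where
  "risk n \<delta> \<mu> = (\<integral>\<^sup>+ y. ennreal (\<Sum>i<n. (\<delta> y i - \<mu> i)\<^sup>2) \<partial>gauss_measure n \<mu>)"

definition worst_risk ::
    "nat \<Rightarrow> (nat \<Rightarrow> real) set \<Rightarrow> ((nat \<Rightarrow> real) \<Rightarrow> (nat \<Rightarrow> real)) \<Rightarrow> ennreal" where
  "worst_risk n K \<delta> = (SUP \<mu>\<in>K. risk n \<delta> \<mu>)"

definition minimax_risk :: "nat \<Rightarrow> (nat \<Rightarrow> real) set \<Rightarrow> ennreal" where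
  "minimax_risk n K = (INF \<delta>\<in>measurable (lebesgue_n n) (lebesgue_n n). worst_risk n K \<delta>)"

definition is_minimax ::
    "nat \<Rightarrow> (nat \<Rightarrow> real) set \<Rightarrow> ((nat \<Rightarrow> real) \<Rightarrow> (nat \<Rightarrow> real)) \<Rightarrow> bool" where
  "is_minimax n K \<delta> \<longleftrightarrow> worst_risk n K \<delta> = minimax_risk n K"

end

theory Submission
  imports Defs "HOL-Real_Asymp.Real_Asymp"
begin

text \<open>
  Let \<open>r\<^sup>2 = \<surd>n\<close>, so that \<open>t\<close> ranges over \<open>[-r, r]\<close>. In high dimension the uniform
  distribution on the ellipsoid puts almost no mass on \<open>t \<ge> r/2\<close>: the map
  \<open>(u, t) \<mapsto> (9u/8, t - r/2)\<close> sends that part into the ellipsoid and expands volume by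
  \<open>(9/8)\<^bsup>n-1\<^esup>\<close>, whereas the likelihood of a typical observation changes only by a factor
  of order \<open>exp \<surd>n\<close>. So if the true mean is the vertex \<open>(0, r)\<close>, the posterior mean of \<open>t\<close> is
  at most \<open>5r/8\<close> with probability at least \<open>3/4\<close>, at a squared loss of order \<open>r\<^sup>2 = \<surd>n\<close>.
  The estimator \<open>(0, Y\<^sub>n)\<close> has risk \<open>\<parallel>u\<parallel>\<^sup>2 + 1 \<le> 2\<close>.
\<close>

section \<open>Change of variables and analytic preliminaries\<close>

text \<open>Product measures are determined by their values on boxes, and on a box the claim factors
  into one-dimensional substitutions. It is applied to a reflection and to a dilation with a
  shift.\<close>

lemma nn_integral_PiM_lborel_affine:
  fixes a b :: "'i \<Rightarrow> real"
  assumes I: "finite I" and a: "\<And>i. i \<in> I \<Longrightarrow> a i \<noteq> 0"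
    and f: "f \<in> borel_measurable (Pi\<^sub>M I (\<lambda>_. lborel))"
  shows "(\<integral>\<^sup>+x. f x \<partial>Pi\<^sub>M I (\<lambda>_. lborel)) =
    ennreal (\<Prod>i\<in>I. \<bar>a i\<bar>) * (\<integral>\<^sup>+x. f (\<lambda>i\<in>I. b i + a i * x i) \<partial>Pi\<^sub>M I (\<lambda>_. lborel))"
proof -
  interpret product_sigma_finite "\<lambda>_::'i. lborel :: real measure" ..
  let ?M = "Pi\<^sub>M I (\<lambda>_. lborel :: real measure)"
  let ?T = "\<lambda>x. \<lambda>i\<in>I. b i + a i * x i"
  let ?N = "density (distr ?M ?M ?T) (\<lambda>_. ennreal (\<Prod>i\<in>I. \<bar>a i\<bar>))"
  have T[measurable]: "?T \<in> measurable ?M ?M"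
    by (intro measurable_restrict) measurable
  have "?N = ?M"
  proof (rule PiM_eqI[OF I])
    fix A :: "'i \<Rightarrow> real set" assume A: "\<And>i. i \<in> I \<Longrightarrow> A i \<in> sets lborel"
    have pre: "?T -` (Pi\<^sub>E I A) \<inter> space ?M = Pi\<^sub>E I (\<lambda>i. (\<lambda>x. b i + a i * x) -` A i)"
      by (auto simp: space_PiM PiE_iff)
    have one: "emeasure lborel (A i) = ennreal \<bar>a i\<bar> * emeasure lborel ((\<lambda>x. b i + a i * x) -` A i)"
      if "i \<in> I" for i
      by (subst lborel_real_affine[OF a[OF that], of "b i"])
         (use A[OF that] in \<open>simp add: emeasure_density_const emeasure_distr\<close>)
    have meas: "(\<lambda>x. b i + a i * x) -` A i \<in> sets lborel" if "i \<in> I" for i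
      using measurable_sets_borel[OF _ , of "\<lambda>x. b i + a i * x" "borel" "A i"] A[OF that] by simp
    have "emeasure ?N (Pi\<^sub>E I A) = ennreal (\<Prod>i\<in>I. \<bar>a i\<bar>) *
        emeasure ?M (Pi\<^sub>E I (\<lambda>i. (\<lambda>x. b i + a i * x) -` A i))"
      using A I by (simp add: emeasure_density_const emeasure_distr pre sets_PiM_I_finite)
    also have "\<dots> = (\<Prod>i\<in>I. ennreal \<bar>a i\<bar>) *
        (\<Prod>i\<in>I. emeasure lborel ((\<lambda>x. b i + a i * x) -` A i))"
      using meas I by (subst emeasure_PiM) (simp_all add: prod_ennreal)
    also have "\<dots> = (\<Prod>i\<in>I. emeasure lborel (A i))"
      by (simp add: one flip: prod.distrib)
    finally show "emeasure ?N (Pi\<^sub>E I A) = (\<Prod>i\<in>I. emeasure lborel (A i))" .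
  qed simp
  then have "(\<integral>\<^sup>+x. f x \<partial>?M) = (\<integral>\<^sup>+x. f x \<partial>?N)"
    by simp
  also have "\<dots> = ennreal (\<Prod>i\<in>I. \<bar>a i\<bar>) * (\<integral>\<^sup>+x. f (?T x) \<partial>?M)"
    using f by (simp add: nn_integral_density nn_integral_distr nn_integral_cmult)
  finally show ?thesis .
qed

text \<open>Geometric decay beats \<open>exp (sqrt n)\<close>. The exponential bounds the likelihood
  cost of the expanding map, the power is the inverse of its Jacobian, and \<open>1/8\<close> will
  bound the posterior mass of \<open>t \<ge> r/2\<close>.\<close>

lemma eventually_exp_sqrt_le_power:
  "\<forall>\<^sub>F n in sequentially. exp (1/2 + sqrt (real n)) * (8/9) ^ (n - 1) \<le> (1/8::real)"
proof -
  \<comment> \<open>Shifting the index by one removes the truncated subtraction in the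
    exponent.\<close>
  have "((\<lambda>n. exp (1/2 + sqrt (real (Suc n))) * (8/9) ^ n) \<longlongrightarrow> 0) sequentially"
    by real_asymp
  then have "\<forall>\<^sub>F n in sequentially. exp (1/2 + sqrt (real (Suc n))) * (8/9) ^ n < (1/8::real)"
    by (rule order_tendstoD(2)) simp
  then have "\<forall>\<^sub>F n in sequentially. exp (1/2 + sqrt (real (Suc n))) * (8/9) ^ n \<le> (1/8::real)"
    by (rule eventually_mono) simp
  then show ?thesis
    by (subst eventually_sequentially_Suc[symmetric]) simp
qed

text \<open>\<open>ennreal\<close> cuts negative values to 0, and the discarded negative part could
  only lower the integral. A non-integrable \<open>f\<close> has Bochner integral 0 by default,
  which \<open>0 \<le> c\<close> covers.\<close>

lemma integral_le_of_nn_integral_le: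
  fixes f :: "'a \<Rightarrow> real"
  assumes le: "(\<integral>\<^sup>+x. ennreal (f x) \<partial>M) \<le> ennreal c" and c: "0 \<le> c"
  shows "(\<integral>x. f x \<partial>M) \<le> c"
proof (cases "integrable M f")
  case True
  have "enn2real (\<integral>\<^sup>+x. ennreal (f x) \<partial>M) \<le> c"
    using enn2real_mono[OF le] c by simp
  moreover have "0 \<le> enn2real (\<integral>\<^sup>+x. ennreal (- f x) \<partial>M)"
    by (rule enn2real_nonneg)
  ultimately show ?thesis
    unfolding real_lebesgue_integral_def[OF True] by linarith
qed (simp add: not_integrable_integral_eq c)

section \<open>Variance and upper tail of a normal variable\<close>

lemma nn_integral_normal_variance:
  "(\<integral>\<^sup>+x. ennreal ((x - m)\<^sup>2) \<partial>density lborel (normal_density m 1)) = 1"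
proof -
  have "has_bochner_integral lborel (\<lambda>x. normal_density m 1 x * (x - m)\<^sup>2) 1"
    using normal_moment_even[of 1 m 1] by (simp add: fact_numeral)
  then have "(\<integral>\<^sup>+x. ennreal (normal_density m 1 x * (x - m)\<^sup>2) \<partial>lborel) = ennreal 1"
    by (intro nn_integral_eq_integral[THEN trans])
       (auto simp: has_bochner_integral_iff)
  then show ?thesis
    by (simp add: nn_integral_density ennreal_mult)
qed

text \<open>Markov's inequality for the squared deviation. Only the upper tail is taken, since the
  later bound on the posterior mean asks for \<open>y k \<le> 2 * r\<close> and no lower bound on
  \<open>y k\<close>.\<close>

lemma emeasure_normal_ge_Chebyshev:
  assumes d: "0 < d"
  shows "emeasure (density lborel (normal_density m 1)) {x. m + d \<le> x} \<le> ennreal (1 / d\<^sup>2)"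
proof -
  let ?N = "density lborel (normal_density m 1)"
  have "emeasure ?N {x. m + d \<le> x} \<le>
      emeasure ?N {x \<in> UNIV. 1 \<le> ennreal (1 / d\<^sup>2) * ennreal ((x - m)\<^sup>2)}"
  proof (rule emeasure_mono)
    have "1 \<le> ennreal (1 / d\<^sup>2) * ennreal ((x - m)\<^sup>2)" if "m + d \<le> x" for x
    proof -
      have "d\<^sup>2 \<le> (x - m)\<^sup>2"
        using that d by (intro power_mono) auto
      then show ?thesis
        using d by (simp add: flip: ennreal_mult)
    qed
    then show "{x. m + d \<le> x} \<subseteq> {x \<in> UNIV. 1 \<le> ennreal (1 / d\<^sup>2) * ennreal ((x - m)\<^sup>2)}"
      by auto
  qed measurable
  also have "\<dots> \<le> ennreal (1 / d\<^sup>2) * (\<integral>\<^sup>+x. ennreal ((x - m)\<^sup>2) * indicator UNIV x \<partial>?N)"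
    by (rule nn_integral_Markov_inequality) auto
  finally show ?thesis
    by (simp add: nn_integral_normal_variance)
qed

section \<open>Coordinates and measurability in the sequence model\<close>

lemma distr_gauss_measure_component:
  assumes "i < n"
  shows "distr (gauss_measure n \<mu>) borel (\<lambda>y. y i) = density lborel (normal_density (\<mu> i) 1)"
proof -
  have "distr (gauss_measure n \<mu>) (density lborel (normal_density (\<mu> i) 1)) (\<lambda>y. y i) =
      density lborel (normal_density (\<mu> i) 1)"
    unfolding gauss_measure_def using assms
    by (intro distr_PiM_component prob_space_normal_density) auto
  then show ?thesis
    by (metis (no_types, lifting) distr_cong sets_density sets_lborel)
qed

lemma sets_gauss_measure [measurable_cong]: "sets (gauss_measure n \<mu>) = sets (lebesgue_n n)"
  unfolding gauss_measure_def lebesgue_n_def by (intro sets_PiM_cong) auto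

lemma space_lebesgue_n: "space (lebesgue_n n) = {..<n} \<rightarrow>\<^sub>E UNIV"
  by (simp add: lebesgue_n_def space_PiM)

lemma measurable_component_lebesgue_n [measurable]:
  "i < n \<Longrightarrow> (\<lambda>x. x i) \<in> borel_measurable (lebesgue_n n)"
  unfolding lebesgue_n_def by measurable

lemma measurable_gauss_likelihood [measurable]:
  "gauss_likelihood n y \<in> borel_measurable (lebesgue_n n)"
  unfolding gauss_likelihood_def normal_density_def by measurable

text \<open>With the dimension written as \<open>Suc k\<close>, the index \<open>n - 1\<close> of
  \<open>t\<close> becomes \<open>k\<close>.\<close>

lemma sets_ellipsoid [measurable]: "ellipsoid (Suc k) \<in> sets (lebesgue_n (Suc k))"
proof -
  have "ellipsoid (Suc k) = {x \<in> space (lebesgue_n (Suc k)).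
      (\<Sum>i<k. (x i)\<^sup>2) + (x k)\<^sup>2 / sqrt (real (Suc k)) \<le> 1}"
    by (auto simp: ellipsoid_def space_lebesgue_n)
  also have "\<dots> \<in> sets (lebesgue_n (Suc k))"
    by measurable
  finally show ?thesis .
qed

lemma sets_ellipsoid_slice:
  "{x \<in> ellipsoid (Suc k). c \<le> x k} \<in> sets (lebesgue_n (Suc k))"
proof -
  have "{x \<in> ellipsoid (Suc k). c \<le> x k} = ellipsoid (Suc k) \<inter> {x \<in> space (lebesgue_n (Suc k)). c \<le> x k}"
    by (auto simp: ellipsoid_def space_lebesgue_n)
  also have "\<dots> \<in> sets (lebesgue_n (Suc k))"
    by measurable
  finally show ?thesis .
qed

lemma emeasure_gauss_measure_component_ge:
  assumes "i < n" "0 < d"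
  shows "emeasure (gauss_measure n \<mu>) {y \<in> space (gauss_measure n \<mu>). \<mu> i + d \<le> y i}
    \<le> ennreal (1 / d\<^sup>2)"
proof -
  have [measurable]: "(\<lambda>y. y i) \<in> borel_measurable (gauss_measure n \<mu>)"
    using assms by measurable
  have "emeasure (gauss_measure n \<mu>) {y \<in> space (gauss_measure n \<mu>). \<mu> i + d \<le> y i} =
      emeasure (distr (gauss_measure n \<mu>) borel (\<lambda>y. y i)) {x. \<mu> i + d \<le> x}"
    by (subst emeasure_distr) (auto intro!: arg_cong[where f = "emeasure _"])
  then show ?thesis
    using emeasure_normal_ge_Chebyshev[OF assms(2), of "\<mu> i"]
    by (simp add: distr_gauss_measure_component[OF assms(1)])
qed

lemma prob_space_gauss_measure: "prob_space (gauss_measure n \<mu>)"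
  unfolding gauss_measure_def by (intro prob_space_PiM prob_space_normal_density) simp

section \<open>Upper bound for the minimax risk\<close>

lemma minimax_risk_ellipsoid_le:
  assumes n: "1 \<le> n"
  shows "minimax_risk n (ellipsoid n) \<le> 2"
proof -
  obtain k where k: "n = Suc k"
    using n by (cases n) auto
  define \<delta> :: "(nat \<Rightarrow> real) \<Rightarrow> nat \<Rightarrow> real"
    where "\<delta> y = (\<lambda>i\<in>{..<n}. if i = k then y i else 0)" for y
  have \<delta>: "\<delta> \<in> measurable (lebesgue_n n) (lebesgue_n n)"
    unfolding \<delta>_def lebesgue_n_def by (intro measurable_restrict) measurable
  have "risk n \<delta> \<mu> \<le> 2" if \<mu>: "\<mu> \<in> ellipsoid n" for \<mu>
  proof -
    interpret prob_space "gauss_measure n \<mu>" by (rule prob_space_gauss_measure)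
    have [measurable]: "(\<lambda>y. y k) \<in> borel_measurable (gauss_measure n \<mu>)"
      using measurable_component_lebesgue_n[of k n] k
      by (simp add: measurable_cong_sets[OF sets_gauss_measure refl])
    have "0 \<le> (\<mu> k)\<^sup>2 / sqrt (real n)"
      by simp
    then have u: "(\<Sum>i<k. (\<mu> i)\<^sup>2) \<le> 1"
      using \<mu> unfolding ellipsoid_def k mem_Collect_eq diff_Suc_1 by linarith
    \<comment> \<open>Since \<open>\<delta>\<close> vanishes in the coordinates of \<open>u\<close>,
      their loss is deterministic; only the last coordinate is random, with expected loss 1.\<close>
    have "(\<Sum>i<n. (\<delta> y i - \<mu> i)\<^sup>2) \<le> 1 + (y k - \<mu> k)\<^sup>2" for y
      using u by (simp add: k \<delta>_def)
    then have "risk n \<delta> \<mu> \<le> (\<integral>\<^sup>+y. 1 + ennreal ((y k - \<mu> k)\<^sup>2) \<partial>gauss_measure n \<mu>)"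
      unfolding risk_def by (intro nn_integral_mono) (simp flip: ennreal_1 ennreal_plus)
    also have "\<dots> = 1 + (\<integral>\<^sup>+y. ennreal ((y k - \<mu> k)\<^sup>2) \<partial>gauss_measure n \<mu>)"
      by (subst nn_integral_add) (auto simp: emeasure_space_1)
    also have "(\<integral>\<^sup>+y. ennreal ((y k - \<mu> k)\<^sup>2) \<partial>gauss_measure n \<mu>) =
        (\<integral>\<^sup>+x. ennreal ((x - \<mu> k)\<^sup>2) \<partial>distr (gauss_measure n \<mu>) borel (\<lambda>y. y k))"
      by (subst nn_integral_distr) auto
    also have "\<dots> = 1"
      using k by (simp add: distr_gauss_measure_component nn_integral_normal_variance)
    finally show ?thesis
      by simp
  qed
  then have "worst_risk n (ellipsoid n) \<delta> \<le> 2"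
    unfolding worst_risk_def by (intro SUP_least)
  then show ?thesis
    unfolding minimax_risk_def using \<delta> by (rule INF_lower2[rotated])
qed

section \<open>Posterior integrals under a uniform prior\<close>

text \<open>Bayes' formula with \<open>emeasure M S\<close> left uncancelled, so that the identity
  also holds when this measure or the normalizing integral is 0 or infinite.\<close>

lemma nn_integral_posterior_uniform:
  assumes [measurable]: "S \<in> sets M" "L \<in> borel_measurable M" "f \<in> borel_measurable M"
  shows "(\<integral>\<^sup>+x. f x \<partial>posterior (uniform_measure M S) L) =
    (\<integral>\<^sup>+x. ennreal (L x) * f x * indicator S x \<partial>M) / emeasure M S /
    ((\<integral>\<^sup>+x. ennreal (L x) * indicator S x \<partial>M) / emeasure M S)"
proof -
  have "(\<integral>\<^sup>+x. f x \<partial>posterior (uniform_measure M S) L) =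
      (\<integral>\<^sup>+x. ennreal (L x) * f x / (\<integral>\<^sup>+x. ennreal (L x) \<partial>uniform_measure M S) \<partial>uniform_measure M S)"
    unfolding posterior_def by (subst nn_integral_density) (simp_all add: divide_ennreal_def ac_simps)
  then show ?thesis
    by (simp add: nn_integral_divide nn_integral_uniform_measure)
qed

section \<open>Posterior mass of the part of the ellipsoid with large \<open>t\<close>\<close>

text \<open>Here \<open>p\<close> stands for the inner product of \<open>y\<close> and
  \<open>u\<close>, \<open>q\<close> for the squared norm of \<open>u\<close>, and \<open>a\<close>
  for the dilation factor. The \<open>cosh\<close> factor grows under dilation, the Gaussian factor
  in \<open>u\<close> loses at most \<open>exp (1/2)\<close> because the dilated point stays in the
  unit ball, and the shift of \<open>t\<close> loses at most \<open>exp (r\<^sup>2)\<close>.\<close>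

lemma cosh_gaussian_ratio_bound:
  fixes a p q r t y :: real
  assumes a: "1 \<le> a" and q: "a\<^sup>2 * q \<le> 1" "0 \<le> q" and t: "r / 2 \<le> t" and y: "y \<le> 2 * r" and r: "0 \<le> r"
  shows "(exp p + exp (- p)) * exp (- q / 2) * exp (- (y - t)\<^sup>2 / 2)
    \<le> exp (1 / 2 + r\<^sup>2) *
      ((exp (a * p) + exp (- (a * p))) * exp (- (a\<^sup>2 * q) / 2) * exp (- (y - (t - r / 2))\<^sup>2 / 2))"
proof -
  have "\<bar>p\<bar> \<le> \<bar>a * p\<bar>"
    using a mult_right_mono[of 1 a "\<bar>p\<bar>"] by (simp add: abs_mult)
  then have "cosh \<bar>p\<bar> \<le> cosh \<bar>a * p\<bar>"
    by (subst cosh_real_nonneg_le_iff) auto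
  then have "cosh p \<le> cosh (a * p)"
    by (simp only: cosh_real_abs)
  then have "exp p + exp (- p) \<le> exp (a * p) + exp (- (a * p))"
    by (simp add: cosh_field_def divide_le_cancel)
  moreover have "exp (- q / 2) * exp (- (y - t)\<^sup>2 / 2) \<le>
      exp (1 / 2 + r\<^sup>2) * (exp (- (a\<^sup>2 * q) / 2) * exp (- (y - (t - r / 2))\<^sup>2 / 2))"
  proof -
    \<comment> \<open>The shift lowers the exponent by
      \<open>r * (y - t) / 2 + r\<^sup>2 / 8\<close>, which is at most
      \<open>7/8 * r\<^sup>2\<close> since \<open>y - t \<le> 2 * r - r / 2\<close>.\<close>
    have "r * (y - t) \<le> r * (3 / 2 * r)"
      using t y r by (intro mult_left_mono) auto
    then have "- (y - t)\<^sup>2 / 2 \<le> r\<^sup>2 - (y - (t - r / 2))\<^sup>2 / 2"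
      by (simp add: power2_eq_square field_simps)
         (use zero_le_square[of r] in argo)
    then show ?thesis
      using q by (simp flip: exp_add)
  qed
  ultimately have "(exp p + exp (- p)) * (exp (- q / 2) * exp (- (y - t)\<^sup>2 / 2)) \<le>
      (exp (a * p) + exp (- (a * p))) *
      (exp (1 / 2 + r\<^sup>2) * (exp (- (a\<^sup>2 * q) / 2) * exp (- (y - (t - r / 2))\<^sup>2 / 2)))"
    by (rule mult_mono) (auto intro: add_nonneg_nonneg)
  then show ?thesis
    by (simp add: ac_simps)
qed

text \<open>Expanding the squares isolates a factor of the data alone and the factor
  \<open>exp (\<Sum>i<k. y i * x i)\<close>, the only one that changes when \<open>u\<close> is
  replaced by \<open>-u\<close>.\<close>

lemma gauss_likelihood_Suc:
  "gauss_likelihood (Suc k) y x =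
    ((1 / sqrt (2 * pi)) ^ Suc k * exp (- (\<Sum>i<k. (y i)\<^sup>2) / 2)) *
    (exp (\<Sum>i<k. y i * x i) * exp (- (\<Sum>i<k. (x i)\<^sup>2) / 2) * exp (- (y k - x k)\<^sup>2 / 2))"
proof -
  have "(\<Prod>i<k. exp (- (y i - x i)\<^sup>2 / 2)) = exp (\<Sum>i<k. - (y i - x i)\<^sup>2 / 2)"
    by (simp add: exp_sum)
  also have "(\<Sum>i<k. - (y i - x i)\<^sup>2 / 2) =
      (\<Sum>i<k. - ((y i)\<^sup>2 / 2) + y i * x i + - ((x i)\<^sup>2 / 2))"
    by (intro sum.cong) (auto simp: power2_eq_square field_simps)
  also have "\<dots> = - (\<Sum>i<k. (y i)\<^sup>2) / 2 + (\<Sum>i<k. y i * x i) + - (\<Sum>i<k. (x i)\<^sup>2) / 2"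
    by (simp add: sum.distrib sum_negf sum_subtractf sum_divide_distrib)
  finally have "(\<Prod>i<k. exp (- (y i - x i)\<^sup>2 / 2)) = exp (- (\<Sum>i<k. (y i)\<^sup>2) / 2) *
      exp (\<Sum>i<k. y i * x i) * exp (- (\<Sum>i<k. (x i)\<^sup>2) / 2)"
    by (simp only: exp_add)
  then show ?thesis
    by (simp add: gauss_likelihood_def normal_density_def prod.distrib power_divide ac_simps prod_dividef)
qed

text \<open>With \<open>\<tau> = t / r\<close> the left side is at most
  \<open>81/64 * (1 - \<tau>\<^sup>2) + (\<tau> - 1/2)\<^sup>2\<close>, which decreases for
  \<open>\<tau> \<ge> 1/2\<close> and equals \<open>243/256\<close> at \<open>\<tau> = 1/2\<close>.
  The dilation \<open>9/8\<close> is admissible because its square is below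
  \<open>4/3\<close>.\<close>

lemma ellipsoid_shrink:
  assumes r: "r\<^sup>2 = sqrt (real (Suc k))" "0 < r" and x: "x \<in> ellipsoid (Suc k)" "r / 2 \<le> x k"
  shows "(\<Sum>i<k. (9 / 8 * x i)\<^sup>2) + (x k - r / 2)\<^sup>2 / r\<^sup>2 \<le> 1"
proof -
  define q where "q = (\<Sum>i<k. (x i)\<^sup>2)"
  define \<tau> where "\<tau> = x k / r"
  have \<tau>: "1 / 2 \<le> \<tau>" and q: "q + \<tau>\<^sup>2 \<le> 1"
    using x r by (simp_all add: \<tau>_def q_def ellipsoid_def field_simps power_divide flip: r(1))
  have "(\<Sum>i<k. (9 / 8 * x i)\<^sup>2) = 81 / 64 * q"
    by (simp add: q_def power_mult_distrib sum_distrib_left power2_eq_square)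
  moreover have "(x k - r / 2)\<^sup>2 / r\<^sup>2 = (\<tau> - 1 / 2)\<^sup>2"
    using r by (simp add: \<tau>_def power2_eq_square field_simps)
  moreover have "81 / 64 * (1 - \<tau>\<^sup>2) + (\<tau> - 1 / 2)\<^sup>2 \<le> 1"
  proof -
    \<comment> \<open>After expansion the goal is linear in \<open>\<tau>\<close> and
      \<open>\<tau>\<^sup>2\<close>, so lower bounds on these two suffice.\<close>
    have "(1 / 2)\<^sup>2 \<le> \<tau>\<^sup>2"
      using \<tau> by (intro power_mono) auto
    then show ?thesis
      using \<tau> by (simp add: power2_eq_square field_simps)
  qed
  ultimately show ?thesis
    using q by argo
qed

text \<open>
  The reflection \<open>F\<close> symmetrizes the likelihood in \<open>u\<close>, turning its dependence on \<open>u\<close> into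
  \<open>cosh\<close>, which only grows under the dilation by \<open>9 / 8\<close>; hence no control of the noise in the
  coordinates of \<open>u\<close> is needed.
\<close>
lemma uniform_posterior_mass_far_le:
  assumes r: "r\<^sup>2 = sqrt (real (Suc k))" "0 < r" and y: "y k \<le> 2 * r"
    and small: "exp (1 / 2 + sqrt (real (Suc k))) * (8 / 9) ^ k \<le> 1 / 8"
  defines "K \<equiv> ellipsoid (Suc k)" and "L \<equiv> gauss_likelihood (Suc k) y"
  shows "8 * (\<integral>\<^sup>+x. ennreal (L x) * indicator {x \<in> K. r / 2 \<le> x k} x \<partial>lebesgue_n (Suc k))
    \<le> (\<integral>\<^sup>+x. ennreal (L x) * indicator K x \<partial>lebesgue_n (Suc k))"
proof -
  define M where "M = lebesgue_n (Suc k)"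
  define A where "A = {x \<in> K. r / 2 \<le> x k}"
  \<comment> \<open>\<open>F\<close> negates \<open>u\<close> and fixes \<open>t\<close>;
    \<open>T\<close> is the expanding map. Both have the shape \<open>b i + a i * x i\<close> of the
    change-of-variables lemma.\<close>
  define F :: "(nat \<Rightarrow> real) \<Rightarrow> nat \<Rightarrow> real"
    where "F x = (\<lambda>i\<in>{..<Suc k}. 0 + (if i < k then - 1 else 1) * x i)" for x
  define T :: "(nat \<Rightarrow> real) \<Rightarrow> nat \<Rightarrow> real"
    where "T x = (\<lambda>i\<in>{..<Suc k}. (if i < k then 0 else - r / 2) + (if i < k then 9 / 8 else 1) * x i)" for x
  define c where "c = (1 / sqrt (2 * pi)) ^ Suc k * exp (- (\<Sum>i<k. (y i)\<^sup>2) / 2)"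
  define H where "H x = (exp (\<Sum>i<k. y i * x i) + exp (- (\<Sum>i<k. y i * x i))) *
    exp (- (\<Sum>i<k. (x i)\<^sup>2) / 2) * exp (- (y k - x k)\<^sup>2 / 2)" for x
  define e where "e = exp (1 / 2 + sqrt (real (Suc k)))"
  have c: "0 \<le> c"
    by (simp add: c_def)
  have H0: "0 \<le> H x" for x
    by (auto simp: H_def intro: add_nonneg_nonneg)
  have L0: "0 \<le> L x" for x
    by (simp add: L_def gauss_likelihood_def prod_nonneg)
  have L: "L \<in> borel_measurable M"
    unfolding L_def M_def by measurable
  have H: "H \<in> borel_measurable M"
    unfolding H_def M_def by measurable
  have K: "K \<in> sets M"
    unfolding K_def M_def by measurable
  have A: "A \<in> sets M"
    unfolding A_def K_def M_def by (rule sets_ellipsoid_slice)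
  note [measurable] = L H K A
  \<comment> \<open>\<open>c * H\<close> is the symmetrized likelihood: \<open>c\<close> depends on
    the data only, and the two exponentials in \<open>H\<close> come from \<open>x\<close> and
    \<open>F x\<close>.\<close>
  have LF: "L x + L (F x) = c * H x" for x
    by (simp add: L_def gauss_likelihood_Suc F_def H_def sum_negf c_def algebra_simps)
  \<comment> \<open>\<open>F\<close> preserves Lebesgue measure and the set \<open>S\<close>, so
    \<open>L\<close> and its composition with \<open>F\<close> have the same integral over
    \<open>S\<close>.\<close>
  have symmetrize: "2 * (\<integral>\<^sup>+x. ennreal (L x) * indicator S x \<partial>M) =
      (\<integral>\<^sup>+x. ennreal (c * H x) * indicator S x \<partial>M)"
    if [measurable]: "S \<in> sets M" and S: "\<And>x. x \<in> space M \<Longrightarrow> F x \<in> S \<longleftrightarrow> x \<in> S" for S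
  proof -
    have F: "F \<in> measurable M M"
      unfolding F_def M_def lebesgue_n_def by (intro measurable_restrict) measurable
    note [measurable] = measurable_compose[OF F L]
    have "(\<integral>\<^sup>+x. ennreal (L x) * indicator S x \<partial>M) =
        (\<integral>\<^sup>+x. ennreal (L (F x)) * indicator S (F x) \<partial>M)"
      unfolding M_def lebesgue_n_def F_def
      by (subst nn_integral_PiM_lborel_affine[where b = "\<lambda>_. 0" and a = "\<lambda>i. if i < k then - 1 else 1"])
         (use that L in \<open>auto simp: M_def lebesgue_n_def\<close>)
    also have "\<dots> = (\<integral>\<^sup>+x. ennreal (L (F x)) * indicator S x \<partial>M)"
      by (intro nn_integral_cong) (auto simp: S indicator_def)
    finally have "2 * (\<integral>\<^sup>+x. ennreal (L x) * indicator S x \<partial>M) =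
        (\<integral>\<^sup>+x. ennreal (L x) * indicator S x \<partial>M) + (\<integral>\<^sup>+x. ennreal (L (F x)) * indicator S x \<partial>M)"
      by (simp add: mult_2)
    also have "\<dots> = (\<integral>\<^sup>+x. ennreal (L x) * indicator S x + ennreal (L (F x)) * indicator S x \<partial>M)"
      by (rule nn_integral_add[symmetric]) measurable
    also have "\<dots> = (\<integral>\<^sup>+x. ennreal (c * H x) * indicator S x \<partial>M)"
      by (simp add: L0 flip: LF distrib_right)
    finally show ?thesis .
  qed
  \<comment> \<open>Both sets depend on \<open>u\<close> only through its norm.\<close>
  have FK: "F x \<in> K \<longleftrightarrow> x \<in> K" "F x \<in> A \<longleftrightarrow> x \<in> A" if "x \<in> space M" for x
    using that by (auto simp: F_def K_def A_def ellipsoid_def M_def space_lebesgue_n)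
  have pointwise: "ennreal (c * H x) * indicator A x \<le> ennreal e * (ennreal (c * H (T x)) * indicator K (T x))"
    for x
  proof (cases "x \<in> A")
    case True
    then have x: "x \<in> ellipsoid (Suc k)" "r / 2 \<le> x k"
      by (auto simp: A_def K_def)
    have shrink: "(\<Sum>i<k. (9 / 8 * x i)\<^sup>2) + (x k - r / 2)\<^sup>2 / r\<^sup>2 \<le> 1"
      by (rule ellipsoid_shrink[OF r x])
    then have "T x \<in> K"
      by (auto simp: T_def K_def ellipsoid_def r(1))
    have sq: "(\<Sum>i<k. (9 / 8 * x i)\<^sup>2) = (9 / 8)\<^sup>2 * (\<Sum>i<k. (x i)\<^sup>2)"
      by (simp only: power_mult_distrib sum_distrib_left)
    moreover have "0 \<le> (x k - r / 2)\<^sup>2 / r\<^sup>2"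
      by simp
    ultimately have "(9 / 8)\<^sup>2 * (\<Sum>i<k. (x i)\<^sup>2) \<le> 1"
      using shrink by linarith
    from cosh_gaussian_ratio_bound[OF _ this _ x(2) y, of "\<Sum>i<k. y i * x i"] r
    have "H x \<le> exp (1 / 2 + r\<^sup>2) * ((exp (9 / 8 * (\<Sum>i<k. y i * x i)) + exp (- (9 / 8 * (\<Sum>i<k. y i * x i)))) *
        exp (- ((9 / 8)\<^sup>2 * (\<Sum>i<k. (x i)\<^sup>2)) / 2) * exp (- (y k - (x k - r / 2))\<^sup>2 / 2))"
      unfolding H_def by (simp add: sum_nonneg)
    also have "9 / 8 * (\<Sum>i<k. y i * x i) = (\<Sum>i<k. y i * T x i)"
      by (simp add: T_def sum_distrib_left mult.left_commute)
    also have "(9 / 8)\<^sup>2 * (\<Sum>i<k. (x i)\<^sup>2) = (\<Sum>i<k. (T x i)\<^sup>2)"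
      unfolding sq[symmetric] by (simp add: T_def)
    also have "x k - r / 2 = T x k"
      by (simp add: T_def)
    finally have "H x \<le> e * H (T x)"
      by (simp only: H_def e_def r(1))
    then have "c * H x \<le> e * (c * H (T x))"
      using c by (metis mult.left_commute mult_left_mono)
    then show ?thesis
      using True \<open>T x \<in> K\<close> c H0 by (simp add: e_def ennreal_leI flip: ennreal_mult)
  qed simp
  have T: "T \<in> measurable M M"
    unfolding T_def M_def lebesgue_n_def by (intro measurable_restrict) measurable
  note [measurable] = measurable_compose[OF T H] measurable_compose[OF T borel_measurable_indicator[OF K]]
  have "8 * (2 * (\<integral>\<^sup>+x. ennreal (L x) * indicator A x \<partial>M)) =
      8 * (\<integral>\<^sup>+x. ennreal (c * H x) * indicator A x \<partial>M)"
    by (simp only: symmetrize[OF A FK(2)])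
  also have "\<dots> \<le> 8 * (\<integral>\<^sup>+x. ennreal e * (ennreal (c * H (T x)) * indicator K (T x)) \<partial>M)"
    by (intro mult_left_mono nn_integral_mono pointwise) auto
  also have "\<dots> = ennreal (8 * e) * (\<integral>\<^sup>+x. ennreal (c * H (T x)) * indicator K (T x) \<partial>M)"
    by (subst nn_integral_cmult) (auto simp: e_def ennreal_mult mult.assoc)
  \<comment> \<open>The hypothesis \<open>small\<close> says exactly
    \<open>8 * e \<le> (9/8) ^ k\<close>, and the right side is the Jacobian of \<open>T\<close>, so
    the next step undoes the substitution.\<close>
  also have "\<dots> \<le> ennreal ((9 / 8) ^ k) * (\<integral>\<^sup>+x. ennreal (c * H (T x)) * indicator K (T x) \<partial>M)"
    using small by (intro mult_right_mono ennreal_leI) (auto simp: e_def field_simps)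
  also have "\<dots> = (\<integral>\<^sup>+x. ennreal (c * H x) * indicator K x \<partial>M)"
    unfolding M_def lebesgue_n_def T_def
    by (subst (2) nn_integral_PiM_lborel_affine[where b = "\<lambda>i. if i < k then 0 else - r / 2"
            and a = "\<lambda>i. if i < k then 9 / 8 else 1"])
       (use K H in \<open>auto simp: M_def lebesgue_n_def\<close>)
  also have "\<dots> = 2 * (\<integral>\<^sup>+x. ennreal (L x) * indicator K x \<partial>M)"
    by (simp only: symmetrize[OF K FK(1)])
  finally have "2 * (8 * (\<integral>\<^sup>+x. ennreal (L x) * indicator A x \<partial>M)) \<le>
      2 * (\<integral>\<^sup>+x. ennreal (L x) * indicator K x \<partial>M)"
    by (simp only: mult.left_commute)
  then show ?thesis
    unfolding M_def A_def by (rule ennreal_mult_le_mult_iff[THEN iffD1, rotated 2]) auto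
qed

section \<open>Upper bound for the posterior mean of \<open>t\<close>\<close>

text \<open>On the ellipsoid \<open>t\<close> is at most \<open>r/2\<close> outside \<open>A\<close>
  and at most \<open>r\<close> on \<open>A\<close>. As \<open>A\<close> carries at most
  \<open>1/8\<close> of the likelihood-weighted volume, the mean is at most
  \<open>r/2 + r/8\<close>.\<close>

lemma unif_posterior_mean_le:
  assumes r: "r\<^sup>2 = sqrt (real (Suc k))" "0 < r" and y: "y k \<le> 2 * r"
    and small: "exp (1 / 2 + sqrt (real (Suc k))) * (8 / 9) ^ k \<le> 1 / 8"
  shows "unif_posterior_mean (Suc k) y k \<le> 5 / 8 * r"
proof -
  define M where "M = lebesgue_n (Suc k)"
  define K where "K = ellipsoid (Suc k)"
  define A where "A = {x \<in> K. r / 2 \<le> x k}"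
  define L where "L = gauss_likelihood (Suc k) y"
  define JK where "JK = (\<integral>\<^sup>+x. ennreal (L x) * indicator K x \<partial>M)"
  define JA where "JA = (\<integral>\<^sup>+x. ennreal (L x) * indicator A x \<partial>M)"
  have L: "L \<in> borel_measurable M"
    unfolding L_def M_def by measurable
  have K: "K \<in> sets M"
    unfolding K_def M_def by measurable
  have A: "A \<in> sets M"
    unfolding A_def K_def M_def by (rule sets_ellipsoid_slice)
  note [measurable] = L K A
  have far: "8 * JA \<le> JK"
    unfolding JA_def JK_def A_def K_def M_def L_def
    using r y small by (rule uniform_posterior_mass_far_le)
  have x_le: "ennreal (x k) * indicator K x \<le> ennreal (r / 2) * indicator K x + ennreal r * indicator A x"
    for x
  proof (cases "x \<in> K")
    case True
    have "0 \<le> (\<Sum>i<k. (x i)\<^sup>2)"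
      by (simp add: sum_nonneg)
    then have "(x k)\<^sup>2 / r\<^sup>2 \<le> 1"
      using True unfolding K_def ellipsoid_def mem_Collect_eq diff_Suc_1 r(1) by linarith
    then have "(x k)\<^sup>2 \<le> r\<^sup>2"
      using r(2) by (simp add: divide_le_eq)
    then have "x k \<le> r"
      using r(2) by (simp add: abs_le_square_iff[symmetric])
    then show ?thesis
      using True r(2) by (auto simp: A_def indicator_def intro!: ennreal_leI simp flip: ennreal_plus)
  qed (simp add: A_def)
  have "(\<integral>\<^sup>+x. ennreal (L x) * ennreal (x k) * indicator K x \<partial>M) \<le>
      (\<integral>\<^sup>+x. ennreal (r / 2) * (ennreal (L x) * indicator K x) + ennreal r * (ennreal (L x) * indicator A x) \<partial>M)"
    using mult_left_mono[OF x_le, of "ennreal (L _)"]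
    by (intro nn_integral_mono) (simp add: distrib_left ac_simps)
  also have "\<dots> = ennreal (r / 2) * JK + ennreal r * JA"
    by (simp add: nn_integral_add nn_integral_cmult JK_def JA_def)
  also have "ennreal r * JA = ennreal (r / 8) * (8 * JA)"
    using r(2) by (simp add: mult.assoc[symmetric] flip: ennreal_numeral ennreal_mult)
  also have "ennreal (r / 2) * JK + \<dots> \<le> ennreal (r / 2) * JK + ennreal (r / 8) * JK"
    by (intro add_left_mono mult_left_mono far) simp
  also have "\<dots> = ennreal (5 / 8 * r) * JK"
    using r(2) by (simp flip: distrib_right ennreal_plus)
  finally have num: "(\<integral>\<^sup>+x. ennreal (L x) * ennreal (x k) * indicator K x \<partial>M) \<le> ennreal (5 / 8 * r) * JK" .
  have "(\<integral>\<^sup>+x. ennreal (x k) \<partial>posterior (uniform_measure M K) L) =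
      (\<integral>\<^sup>+x. ennreal (L x) * ennreal (x k) * indicator K x \<partial>M) / emeasure M K / (JK / emeasure M K)"
    unfolding JK_def by (rule nn_integral_posterior_uniform) (use K L in \<open>simp_all add: M_def\<close>)
  also have "\<dots> \<le> ennreal (5 / 8 * r) * JK / emeasure M K / (JK / emeasure M K)"
    by (intro divide_right_mono_ennreal num)
  also have "\<dots> = ennreal (5 / 8 * r) * ((JK / emeasure M K) / (JK / emeasure M K))"
    by (simp add: ennreal_times_divide)
  also have "\<dots> \<le> ennreal (5 / 8 * r) * 1"
  proof (intro mult_left_mono)
    \<comment> \<open>The quotient is 1 except for \<open>a = 0\<close> and
      \<open>a = \<top>\<close>, where it is 0 in \<open>ennreal\<close>; the bound thus covers a
      degenerate normalization.\<close>
    show "a / a \<le> 1" for a :: ennreal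
      by (cases "a = 0 \<or> a = \<top>") (auto simp: top.not_eq_extremum)
  qed simp
  finally have "(\<integral>x. x k \<partial>posterior (uniform_measure M K) L) \<le> 5 / 8 * r"
    using r(2) by (intro integral_le_of_nn_integral_le) auto
  then show ?thesis
    by (simp add: unif_posterior_mean_def posterior_mean_def M_def K_def L_def)
qed

section \<open>Risk of the posterior mean at the vertex of the ellipsoid\<close>

lemma worst_risk_unif_posterior_mean_ge:
  assumes k: "15 \<le> k"
    and small: "exp (1 / 2 + sqrt (real (Suc k))) * (8 / 9) ^ k \<le> 1 / 8"
  shows "ennreal (1 / 32 * sqrt (real (Suc k)))
    \<le> worst_risk (Suc k) (ellipsoid (Suc k)) (unif_posterior_mean (Suc k))"
proof -
  define r where "r = sqrt (sqrt (real (Suc k)))"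
  have r: "r\<^sup>2 = sqrt (real (Suc k))" "0 < r"
    by (simp_all add: r_def)
  \<comment> \<open>\<open>k \<ge> 15\<close> means dimension at least 16, hence
    \<open>r \<ge> 2\<close>, which makes the Chebyshev bound \<open>1 / r\<^sup>2\<close> at most
    \<open>1/4\<close>.\<close>
  have "sqrt (sqrt 16) \<le> r"
    unfolding r_def using k by (intro real_sqrt_le_mono) simp
  moreover have "sqrt (sqrt 16) = (2::real)"
    by (simp add: real_sqrt_unique)
  ultimately have r2: "2 \<le> r"
    by simp
  define \<mu> :: "nat \<Rightarrow> real" where "\<mu> = (\<lambda>i\<in>{..<Suc k}. if i = k then r else 0)"
  have \<mu>: "\<mu> \<in> ellipsoid (Suc k)"
    using r by (simp add: \<mu>_def ellipsoid_def)
  let ?G = "gauss_measure (Suc k) \<mu>"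
  interpret prob_space ?G by (rule prob_space_gauss_measure)
  \<comment> \<open>\<open>B\<close> is the bad event: as \<open>\<mu> k = r\<close>, its complement
    is \<open>y k < 2 * r\<close>.\<close>
  define B where "B = {y \<in> space ?G. \<mu> k + r \<le> y k}"
  have B: "B \<in> events"
    unfolding B_def using measurable_component_lebesgue_n[of k "Suc k"]
    by (simp add: measurable_cong_sets[OF sets_gauss_measure[of "Suc k" \<mu>, symmetric] refl])
  have "emeasure ?G B \<le> ennreal (1 / r\<^sup>2)"
    unfolding B_def by (rule emeasure_gauss_measure_component_ge) (use r in auto)
  also have "\<dots> \<le> ennreal (1 / 2\<^sup>2)"
    using r2 by (intro ennreal_leI divide_left_mono power_mono) auto
  finally have "prob B \<le> 1 / 4"
    by (simp add: emeasure_eq_measure)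
  then have prob: "3 / 4 \<le> prob (space ?G - B)"
    using B by (simp add: prob_compl)
  \<comment> \<open>The last coordinate alone misses the true value \<open>r\<close> by at least
    \<open>r - 5/8 * r = 3/8 * r\<close>.\<close>
  have loss: "9 / 64 * r\<^sup>2 \<le> (\<Sum>i<Suc k. (unif_posterior_mean (Suc k) y i - \<mu> i)\<^sup>2)"
    if "y \<in> space ?G - B" for y
  proof -
    have "unif_posterior_mean (Suc k) y k \<le> 5 / 8 * r"
      using that by (intro unif_posterior_mean_le[OF r _ small]) (auto simp: B_def \<mu>_def)
    then have "(3 / 8 * r)\<^sup>2 \<le> (\<mu> k - unif_posterior_mean (Suc k) y k)\<^sup>2"
      using r(2) by (intro power_mono) (auto simp: \<mu>_def)
    also have "\<dots> = (unif_posterior_mean (Suc k) y k - \<mu> k)\<^sup>2"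
      by (rule power2_commute)
    also have "\<dots> \<le> (\<Sum>i<Suc k. (unif_posterior_mean (Suc k) y i - \<mu> i)\<^sup>2)"
      by (intro member_le_sum) auto
    finally show ?thesis
      by (simp add: power_mult_distrib power_divide)
  qed
  \<comment> \<open>The product \<open>9/64 * 3/4 = 27/256\<close> exceeds
    \<open>1/32\<close>.\<close>
  have "ennreal (1 / 32 * r\<^sup>2) \<le> ennreal (9 / 64 * r\<^sup>2 * prob (space ?G - B))"
    using prob r by (intro ennreal_leI order_trans[OF _ mult_left_mono[OF prob]]) auto
  also have "\<dots> = (\<integral>\<^sup>+y. ennreal (9 / 64 * r\<^sup>2) * indicator (space ?G - B) y \<partial>?G)"
    using B by (subst nn_integral_cmult_indicator) (auto simp: emeasure_eq_measure simp flip: ennreal_mult)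
  \<comment> \<open>\<open>nn_integral\<close> is monotone for arbitrary functions, so the pointwise
    bound on the loss passes directly to the risk.\<close>
  also have "\<dots> \<le> risk (Suc k) (unif_posterior_mean (Suc k)) \<mu>"
    unfolding risk_def
    by (intro nn_integral_mono) (use loss in \<open>auto split: split_indicator intro!: ennreal_leI\<close>)
  also have "\<dots> \<le> worst_risk (Suc k) (ellipsoid (Suc k)) (unif_posterior_mean (Suc k))"
    unfolding worst_risk_def using \<mu> by (rule SUP_upper)
  finally show ?thesis
    using r by simp
qed

section \<open>Large dimensions and comparison with the minimax risk\<close>

lemma eventually_worst_risk_unif_posterior_mean_ge:
  "\<exists>n0\<ge>1. \<forall>n\<ge>n0. ennreal (1 / 32 * sqrt (real n)) \<le> worst_risk n (ellipsoid n) (unif_posterior_mean n)"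
proof -
  obtain n0 where n0: "\<And>n. n0 \<le> n \<Longrightarrow> exp (1 / 2 + sqrt (real n)) * (8 / 9) ^ (n - 1) \<le> (1 / 8 :: real)"
    using eventually_exp_sqrt_le_power unfolding eventually_sequentially by blast
  have "ennreal (1 / 32 * sqrt (real n)) \<le> worst_risk n (ellipsoid n) (unif_posterior_mean n)"
    if "max n0 16 \<le> n" for n
    using that worst_risk_unif_posterior_mean_ge[of "n - 1"] n0[of n] by (cases n) auto
  then show ?thesis
    by (intro exI[of _ "max n0 16"]) auto
qed

theorem propositionF1:
  shows "(\<exists>c::real. c > 0 \<and> (\<exists>n0::nat. \<forall>n\<ge>n0.
            worst_risk n (ellipsoid n) (unif_posterior_mean n) \<ge> ennreal (c * sqrt (real n))))
       \<and> (\<forall>n::nat. n \<ge> 1 \<longrightarrow> minimax_risk n (ellipsoid n) \<le> 2)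
       \<and> (\<exists>n0::nat. \<forall>n\<ge>n0. \<not> is_minimax n (ellipsoid n) (unif_posterior_mean n))
       \<and> (\<exists>c::real. c > 0 \<and> (\<exists>n0::nat. \<forall>n\<ge>n0.
            worst_risk n (ellipsoid n) (unif_posterior_mean n)
              \<ge> ennreal (c * sqrt (real n)) * minimax_risk n (ellipsoid n)))
       \<and> (\<exists>n0::nat. \<forall>n\<ge>n0.
            worst_risk n (ellipsoid n) (unif_posterior_mean n) \<ge> ennreal (1 / 32 * sqrt (real n)))"
proof -
  obtain n0 where n0: "1 \<le> n0" and ge: "\<And>n. n0 \<le> n \<Longrightarrow>
      ennreal (1 / 32 * sqrt (real n)) \<le> worst_risk n (ellipsoid n) (unif_posterior_mean n)"
    using eventually_worst_risk_unif_posterior_mean_ge by blast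
  \<comment> \<open>Minimaxity would give \<open>sqrt n / 32 \<le> 2\<close>, that is
    \<open>sqrt n \<le> 64\<close>, which fails from \<open>65\<^sup>2\<close> on.\<close>
  have not_minimax: "\<not> is_minimax n (ellipsoid n) (unif_posterior_mean n)" if "max n0 (65\<^sup>2) \<le> n" for n
  proof
    assume "is_minimax n (ellipsoid n) (unif_posterior_mean n)"
    then have "ennreal (1 / 32 * sqrt (real n)) \<le> 2"
      using ge[of n] minimax_risk_ellipsoid_le[of n] n0 that unfolding is_minimax_def by simp
    then have "sqrt (real n) \<le> 64"
      by (simp flip: ennreal_numeral)
    moreover have "sqrt (65\<^sup>2) \<le> sqrt (real n)"
      using that by (intro real_sqrt_le_mono) (simp add: numeral_power_le_of_nat_cancel_iff)
    ultimately show False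
      by simp
  qed
  \<comment> \<open>The constant is \<open>1/32\<close> divided by the bound 2 on the minimax
    risk.\<close>
  have ratio: "ennreal (1 / 64 * sqrt (real n)) * minimax_risk n (ellipsoid n)
      \<le> worst_risk n (ellipsoid n) (unif_posterior_mean n)" if "n0 \<le> n" for n
  proof -
    have "ennreal (1 / 64 * sqrt (real n)) * minimax_risk n (ellipsoid n)
        \<le> ennreal (1 / 64 * sqrt (real n)) * 2"
      using n0 that by (intro mult_left_mono minimax_risk_ellipsoid_le) auto
    also have "\<dots> = ennreal (1 / 32 * sqrt (real n))"
      by (simp flip: ennreal_numeral ennreal_mult)
    finally show ?thesis
      using ge[OF that] by order
  qed
  show ?thesis
  proof (intro conjI)
    show "\<exists>c::real. c > 0 \<and> (\<exists>n0::nat. \<forall>n\<ge>n0.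
        worst_risk n (ellipsoid n) (unif_posterior_mean n) \<ge> ennreal (c * sqrt (real n)))"
      using ge by (intro exI[of _ "1 / 32"]) auto
    show "\<exists>c::real. c > 0 \<and> (\<exists>n0::nat. \<forall>n\<ge>n0.
        worst_risk n (ellipsoid n) (unif_posterior_mean n)
          \<ge> ennreal (c * sqrt (real n)) * minimax_risk n (ellipsoid n))"
      using ratio by (intro exI[of _ "1 / 64"]) auto
  qed (use minimax_risk_ellipsoid_le not_minimax ge in blast)+
qed

end
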